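(* For every rational number $\alpha\in(0,1)$ there is a set $E_\alpha\subseteq\mathbb{N}$ such that for infinitely many positive integers $n$ (with $n^\alpha$ and $n^{1-\alpha}$ integers) we have $$(n^{\alpha})!^{\,n^{1-\alpha}}\le T(n,E_\alpha)\le\frac{n!}{(n^{1-\alpha})!^{\,n^{\alpha}}}$$ and $$(n^{1-\alpha})!^{\,n^{\alpha}}\le T(n,\mathbb{N}\setminus E_\alpha)\le\frac{n!}{(n^{\alpha})!^{\,n^{1-\alpha}}}.$$
   Context: Here $\mathbb{N}=\{1,2,3,\dots\}$ and $[n]=\{1,\dots,n\}$. For $D\subseteq\mathbb{N}$, two permutations $\pi,\sigma$ of $[n]$ are called $G(D)$-different if there is a position $i\in[n]$ with $|\pi(i)-\sigma(i)|\in D$. $T(n,D)$ denotes the maximum cardinality of a set of permutations of $[n]$ any two distinct members of which are $G(D)$-different. *)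

theory Defs
  imports Complex_Main "HOL-Combinatorics.Permutations"
begin

(* Permutations of [n] are functions f with "f permutes {1..n}", i.e. bijections of {1..n}
   extended by the identity to all of nat. *)

definition G_different :: "nat \<Rightarrow> nat set \<Rightarrow> (nat \<Rightarrow> nat) \<Rightarrow> (nat \<Rightarrow> nat) \<Rightarrow> bool" where
  "G_different n D p q \<longleftrightarrow> (\<exists>i\<in>{1..n}. nat \<bar>int (p i) - int (q i)\<bar> \<in> D)"

definition G_different_families :: "nat \<Rightarrow> nat set \<Rightarrow> (nat \<Rightarrow> nat) set set" where
  "G_different_families n D =
     {A. A \<subseteq> {p. p permutes {1..n}} \<and> pairwise (G_different n D) A}"

definition T :: "nat \<Rightarrow> nat set \<Rightarrow> nat" where
  "T n D = Max (card ` G_different_families n D)"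

(* Max is meaningful here: it ranges over a finite nonempty set. *)

lemma finite_G_different_families: "finite (G_different_families n D)"
proof (rule finite_subset)
  show "G_different_families n D \<subseteq> Pow {p. p permutes {1..n}}"
    by (auto simp: G_different_families_def)
  show "finite (Pow {p. p permutes {1..n}})"
    by (simp add: finite_permutations)
qed

lemma G_different_families_nonempty: "G_different_families n D \<noteq> {}"
proof -
  have "{} \<in> G_different_families n D"
    by (simp add: G_different_families_def)
  then show ?thesis by blast
qed

end

theory Submission
  imports Defs "HOL-Computational_Algebra.Euclidean_Algorithm" "HOL-Library.FuncSet" "HOL-Library.Infinite_Set"
begin

text \<open>
  Write \<open>\<alpha> = r / q\<close> and let \<open>E\<close> consist of the positive integers whose 2-adic valuation is
  less than \<open>r\<close> modulo \<open>q\<close>. For \<open>n = 2 ^ (q * k)\<close>, group the numbers below \<open>n\<close> according to their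
  binary digits at the positions outside the residues \<open>{..<r}\<close>: two members of the same group first
  differ at a position with residue less than \<open>r\<close>, so their difference lies in \<open>E\<close>. The permutations
  preserving every group are therefore pairwise \<open>G(E)\<close>-different, which gives the lower bound; the
  complement of \<open>E\<close> is treated symmetrically. The upper bounds follow from the clique-coclique
  inequality: a \<open>G(D)\<close>-different family times a family without any two \<open>G(D)\<close>-different members
  has at most \<open>n!\<close> elements.
\<close>

section \<open>The clique-coclique inequality\<close>

lemma G_different_family_card_le_T:
  assumes "A \<in> G_different_families n D"
  shows "card A \<le> T n D"
  unfolding T_def using assms finite_G_different_families by (intro Max_ge) auto

lemma T_attained:
  obtains A where "A \<in> G_different_families n D" "card A = T n D"
proof -
  have "T n D \<in> card ` G_different_families n D"
    unfolding T_def
    using finite_G_different_families G_different_families_nonempty by (intro Max_in) auto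
  then show ?thesis using that by auto
qed

text \<open>The pair \<open>(p, q)\<close> can be recovered from \<open>s = inv p \<circ> q\<close>.
  If \<open>(p', q')\<close> yields the same \<open>s\<close>, then \<open>q\<close> and
  \<open>q'\<close> are \<open>p\<close> and \<open>p'\<close> precomposed with \<open>s\<close>, so
  a position \<open>i\<close> witnessing that \<open>p\<close> and \<open>p'\<close> are different
  becomes the position \<open>inv s i\<close> witnessing the same for \<open>q\<close> and
  \<open>q'\<close>, which \<open>B\<close> forbids.\<close>

lemma clique_coclique_bound:
  assumes A: "A \<in> G_different_families n D"
    and B: "B \<subseteq> {p. p permutes {1..n}}" "\<And>p q. p \<in> B \<Longrightarrow> q \<in> B \<Longrightarrow> p \<noteq> q \<Longrightarrow> \<not> G_different n D p q"
  shows "card A * card B \<le> fact n"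
proof -
  let ?h = "\<lambda>(p, q). inv p \<circ> q"
  have Ap: "\<And>p. p \<in> A \<Longrightarrow> p permutes {1..n}"
    and Ad: "\<And>p q. p \<in> A \<Longrightarrow> q \<in> A \<Longrightarrow> p \<noteq> q \<Longrightarrow> G_different n D p q"
    using A by (auto simp: G_different_families_def pairwise_def)
  have Bp: "\<And>p. p \<in> B \<Longrightarrow> p permutes {1..n}" using B(1) by auto
  have "inj_on ?h (A \<times> B)"
  proof (rule inj_onI, clarify)
    fix p q p' q'
    assume m: "p \<in> A" "q \<in> B" "p' \<in> A" "q' \<in> B" and eq: "inv p \<circ> q = inv p' \<circ> q'"
    define s where "s = inv p \<circ> q"
    have s: "s permutes {1..n}"
      unfolding s_def using m Ap Bp by (intro permutes_compose permutes_inv) auto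
    have q: "q j = p (s j)" for j
      unfolding s_def using permutes_inverses(1)[OF Ap[OF m(1)]] by simp
    have q': "q' j = p' (s j)" for j
      unfolding s_def eq using permutes_inverses(1)[OF Ap[OF m(3)]] by simp
    have "p = p'"
    proof (rule ccontr)
      assume "p \<noteq> p'"
      then obtain i where i: "i \<in> {1..n}" "nat \<bar>int (p i) - int (p' i)\<bar> \<in> D" "G_different n D p p'"
        using Ad[OF m(1,3)] by (auto simp: G_different_def)
      obtain j where j: "j \<in> {1..n}" "s j = i"
        using permutes_image[OF s] i(1) by (metis imageE)
      have "G_different n D q q'"
        using i j q q' by (auto simp: G_different_def intro!: bexI[of _ j])
      then have "q = q'" using B(2)[OF m(2,4)] by blast
      moreover have "p = q \<circ> inv s" "p' = q' \<circ> inv s"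
        using permutes_inverses(1)[OF s] q q' by auto
      ultimately show False using \<open>p \<noteq> p'\<close> by simp
    qed
    moreover from this have "q = q'" using q q' by auto
    ultimately show "p = p' \<and> q = q'" by simp
  qed
  moreover have "?h ` (A \<times> B) \<subseteq> {p. p permutes {1..n}}"
    using Ap Bp by (auto intro: permutes_compose permutes_inv)
  ultimately have "card (A \<times> B) \<le> card {p. p permutes {1..n}}"
    by (intro card_inj_on_le[of ?h]) (auto simp: finite_permutations)
  then show ?thesis by (simp add: card_cartesian_product card_permutations[OF refl])
qed

section \<open>Permutations preserving the fibres of a map\<close>

text \<open>Permutations chosen independently on the fibres glue to a permutation of
  \<open>X\<close> that preserves every fibre, and different choices glue to different
  permutations.\<close>

lemma prod_fact_le_card_fibre_preserving:
  fixes f :: "'a \<Rightarrow> 'b"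
  assumes X: "finite X" and J: "finite J" "f ` X \<subseteq> J"
  shows "(\<Prod>j\<in>J. fact (card {x\<in>X. f x = j})) \<le> card {p. p permutes X \<and> (\<forall>x\<in>X. f (p x) = f x)}"
proof -
  let ?F = "\<lambda>j. {x\<in>X. f x = j}"
  let ?P = "Pi\<^sub>E J (\<lambda>j. {p. p permutes ?F j})"
  let ?h = "\<lambda>\<phi> x. if x \<in> X then \<phi> (f x) x else x"
  have perm: "\<phi> j permutes ?F j" if "\<phi> \<in> ?P" "j \<in> J" for \<phi> j
    using that by (auto simp: PiE_iff)
  have maps: "\<phi> (f x) x \<in> X" "f (\<phi> (f x) x) = f x" if "\<phi> \<in> ?P" "x \<in> X" for \<phi> x
    using permutes_in_image[OF perm[OF that(1), of "f x"], of x] that(2) J(2) by auto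
  have "?h \<phi> permutes X" if \<phi>: "\<phi> \<in> ?P" for \<phi>
  proof (rule bij_imp_permutes)
    have "inj_on (?h \<phi>) X"
    proof (rule inj_onI)
      fix x y assume xy: "x \<in> X" "y \<in> X" and eq: "?h \<phi> x = ?h \<phi> y"
      then have "f x = f y" using maps(2)[OF \<phi>, of x] maps(2)[OF \<phi>, of y] by simp
      moreover have "inj (\<phi> (f x))" using perm[OF \<phi>, of "f x"] xy J(2) permutes_inj by blast
      ultimately show "x = y" using eq xy by (simp add: inj_eq)
    qed
    moreover have "?h \<phi> ` X \<subseteq> X" using maps(1)[OF \<phi>] by auto
    ultimately show "bij_betw (?h \<phi>) X X"
      unfolding bij_betw_def using endo_inj_surj[OF X] by blast
  qed simp
  then have sub: "?h ` ?P \<subseteq> {p. p permutes X \<and> (\<forall>x\<in>X. f (p x) = f x)}"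
    using maps(2) by auto
  have "inj_on ?h ?P"
  proof (rule inj_onI)
    fix \<phi> \<psi> assume m: "\<phi> \<in> ?P" "\<psi> \<in> ?P" and eq: "?h \<phi> = ?h \<psi>"
    \<comment> \<open>On the fibre of \<open>j\<close> the glued map agrees with the component at
      \<open>j\<close>; off that fibre both components are the identity.\<close>
    have "\<phi> j x = \<psi> j x" if "j \<in> J" for j x
    proof (cases "x \<in> ?F j")
      case True
      then show ?thesis using fun_cong[OF eq, of x] by auto
    next
      case False
      then show ?thesis using perm[OF m(1) that] perm[OF m(2) that] by (simp add: permutes_not_in)
    qed
    then show "\<phi> = \<psi>" using m by (intro PiE_ext) auto
  qed
  then have "card ?P \<le> card {p. p permutes X \<and> (\<forall>x\<in>X. f (p x) = f x)}"
    using sub X by (intro card_inj_on_le[of ?h]) (auto intro: finite_subset[OF _ finite_permutations[OF X]])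
  moreover have "card ?P = (\<Prod>j\<in>J. fact (card (?F j)))"
    using J X by (simp add: card_PiE card_permutations)
  ultimately show ?thesis by simp
qed

definition fibre_perms :: "nat \<Rightarrow> (nat \<Rightarrow> nat) \<Rightarrow> (nat \<Rightarrow> nat) set" where
  "fibre_perms n f = {p. p permutes {1..n} \<and> (\<forall>x\<in>{1..n}. f (p x) = f x)}"

text \<open>Two fibre-preserving permutations send a position into the same fibre, so their values
  there coincide or differ by an element of \<open>D\<close>. One family thus serves twice: as a
  clique for \<open>D\<close>, and as a coclique for \<open>D'\<close>, where the clique-coclique
  inequality applies.\<close>

lemma fibre_perms_bounds:
  assumes clique: "\<And>x y. x \<in> {1..n} \<Longrightarrow> y \<in> {1..n} \<Longrightarrow> x \<noteq> y \<Longrightarrow> f x = f y \<Longrightarrow>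
      nat \<bar>int x - int y\<bar> \<in> D"
    and range: "f ` {1..n} \<subseteq> {..<b}"
    and size: "\<And>j. j < b \<Longrightarrow> card {x\<in>{1..n}. f x = j} = a"
    and disj: "D \<inter> D' = {}" "0 \<notin> D'"
  shows "fact a ^ b \<le> T n D" and "T n D' * fact a ^ b \<le> fact n"
proof -
  have "fact a ^ b = (\<Prod>j<b. fact (card {x\<in>{1..n}. f x = j}))"
    using size by simp
  also have "\<dots> \<le> card (fibre_perms n f)"
    unfolding fibre_perms_def
    by (rule prod_fact_le_card_fibre_preserving[OF _ _ range]) auto
  finally have card: "fact a ^ b \<le> card (fibre_perms n f)" .
  have val: "p i = q i \<or> nat \<bar>int (p i) - int (q i)\<bar> \<in> D"
    if "p \<in> fibre_perms n f" "q \<in> fibre_perms n f" "i \<in> {1..n}" for p q i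
  proof -
    have perm: "p permutes {1..n}" "q permutes {1..n}" and "f (p i) = f (q i)"
      using that by (simp_all add: fibre_perms_def)
    moreover have "p i \<in> {1..n}" "q i \<in> {1..n}"
      using perm[THEN permutes_in_image] that(3) by blast+
    ultimately show ?thesis using clique by blast
  qed
  have "G_different n D p q"
    if m: "p \<in> fibre_perms n f" "q \<in> fibre_perms n f" and "p \<noteq> q" for p q
  proof -
    obtain i where "p i \<noteq> q i" using \<open>p \<noteq> q\<close> by auto
    \<comment> \<open>Both permutations are the identity outside \<open>{1..n}\<close>, so they can
      only disagree inside.\<close>
    moreover from this have "i \<in> {1..n}"
      using m permutes_not_in[of p "{1..n}" i] permutes_not_in[of q "{1..n}" i]
      unfolding fibre_perms_def by (metis (no_types, lifting) mem_Collect_eq)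
    ultimately show ?thesis using val[OF m] unfolding G_different_def by blast
  qed
  then have "fibre_perms n f \<in> G_different_families n D"
    by (auto simp: G_different_families_def pairwise_def fibre_perms_def)
  with card show "fact a ^ b \<le> T n D"
    using G_different_family_card_le_T le_trans by blast
  obtain A where A: "A \<in> G_different_families n D'" "card A = T n D'" by (rule T_attained)
  \<comment> \<open>Equal values have difference 0, which \<open>D'\<close> omits; unequal values
    have a difference in \<open>D\<close>, which is disjoint from \<open>D'\<close>.\<close>
  have "\<not> G_different n D' p q" if "p \<in> fibre_perms n f" "q \<in> fibre_perms n f" for p q
    using val[OF that] disj unfolding G_different_def by (metis IntI abs_zero diff_self empty_iff nat_0)
  then have "card A * card (fibre_perms n f) \<le> fact n"
    by (intro clique_coclique_bound[OF A(1)]) (simp_all add: fibre_perms_def Collect_mono)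
  moreover have "card A * fact a ^ b \<le> card A * card (fibre_perms n f)"
    using card by (rule mult_le_mono2)
  ultimately show "T n D' * fact a ^ b \<le> fact n" unfolding A(2) by (rule le_trans[rotated])
qed

section \<open>Binary digits and 2-adic valuations\<close>

text \<open>Since \<open>multiplicity 2 0 = 0\<close>, positivity has to be demanded explicitly; it
  makes the sets for \<open>S\<close> and \<open>- S\<close> complementary within the positive
  integers.\<close>

definition two_adic :: "nat set \<Rightarrow> nat set" where
  "two_adic S = {d. 0 < d \<and> multiplicity 2 d \<in> S}"

text \<open>The number formed by those of the lowest \<open>L\<close> binary digits of \<open>x\<close> whose positions lie outside \<open>S\<close>.\<close>

primrec digits_off :: "nat \<Rightarrow> nat set \<Rightarrow> nat \<Rightarrow> nat" where
  "digits_off 0 S x = 0"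
| "digits_off (Suc L) S x = (if 0 \<in> S then digits_off L (Suc -` S) (x div 2)
     else 2 * digits_off L (Suc -` S) (x div 2) + x mod 2)"

lemma two_adic_odd: "odd d \<Longrightarrow> d \<in> two_adic S \<longleftrightarrow> 0 \<in> S"
  by (auto simp: two_adic_def not_dvd_imp_multiplicity_0 odd_pos)

lemma two_adic_double: "2 * d \<in> two_adic S \<longleftrightarrow> d \<in> two_adic (Suc -` S)"
  by (auto simp: two_adic_def multiplicity_times_same)

text \<open>The valuation of \<open>x - y\<close> is the lowest position at which the binary digits
  differ, and agreement of the digits outside \<open>S\<close> forces that position into
  \<open>S\<close>. The induction strips the lowest digit and shifts \<open>S\<close> down by
  one.\<close>

lemma digits_off_eq_imp_two_adic:
  assumes "x < 2 ^ L" "y < 2 ^ L" "x \<noteq> y" "digits_off L S x = digits_off L S y"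
  shows "nat \<bar>int x - int y\<bar> \<in> two_adic S"
  using assms
proof (induction L arbitrary: S x y)
  case (Suc L)
  show ?case
  proof (cases "x mod 2 = y mod 2")
    case True
    then have ne: "x div 2 \<noteq> y div 2" using Suc.prems(3) by (metis div_mult_mod_eq)
    have "digits_off L (Suc -` S) (x div 2) = digits_off L (Suc -` S) (y div 2)"
      using Suc.prems(4) True by (auto split: if_splits)
    then have "nat \<bar>int (x div 2) - int (y div 2)\<bar> \<in> two_adic (Suc -` S)"
      using Suc.prems(1,2) ne by (intro Suc.IH less_mult_imp_div_less) (simp_all add: mult.commute)
    moreover have "nat \<bar>int x - int y\<bar> = 2 * nat \<bar>int (x div 2) - int (y div 2)\<bar>"
    proof -
      define u v e where "u = x div 2" and "v = y div 2" and "e = x mod 2"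
      have "x = 2 * u + e" by (simp add: u_def e_def)
      moreover have "y = 2 * v + e" by (simp add: v_def e_def True)
      ultimately have "int x - int y = 2 * (int (x div 2) - int (y div 2))"
        unfolding u_def[symmetric] v_def[symmetric] by simp
      then show ?thesis by (simp only: abs_mult nat_mult_distrib) simp
    qed
    ultimately show ?thesis by (simp only: two_adic_double)
  next
    case False
    \<comment> \<open>If position 0 were retained, the parity of the common value of
      \<open>digits_off\<close> would give \<open>x\<close> and \<open>y\<close> the same lowest
      digit.\<close>
    have "0 \<in> S"
    proof (rule ccontr)
      assume "0 \<notin> S"
      then have "(2 * digits_off L (Suc -` S) (x div 2) + x mod 2) mod 2
          = (2 * digits_off L (Suc -` S) (y div 2) + y mod 2) mod 2"
        using Suc.prems(4) by simp
      then show False using False by simp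
    qed
    moreover have "odd (nat \<bar>int x - int y\<bar>)"
      using False by (auto simp: even_nat_iff mod2_eq_if split: if_splits)
    ultimately show ?thesis using two_adic_odd by blast
  qed
qed simp

lemma card_lessThan_Suc_Int:
  "card ({..<Suc L} \<inter> S) = (if 0 \<in> S then 1 else 0) + card ({..<L} \<inter> Suc -` S)"
proof -
  have "{..<Suc L} \<inter> S = (if 0 \<in> S then {0} else {}) \<union> Suc ` ({..<L} \<inter> Suc -` S)"
    by (auto simp: less_Suc_eq_0_disj)
  then show ?thesis by (auto simp: card_image card_insert_if)
qed

lemma digits_off_less: "digits_off L S x < 2 ^ card ({..<L} \<inter> - S)"
proof (induction L arbitrary: S x)
  case (Suc L)
  have "digits_off L (Suc -` S) (x div 2) < 2 ^ card ({..<L} \<inter> Suc -` (- S))"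
    using Suc.IH[of "Suc -` S" "x div 2"] by (simp add: vimage_Compl)
  then show ?case unfolding card_lessThan_Suc_Int by auto
qed simp

text \<open>The value \<open>j\<close> prescribes the digits at the positions outside
  \<open>S\<close>, and those at positions in \<open>S\<close> remain free.\<close>

lemma card_digits_off_fibre:
  assumes "j < 2 ^ card ({..<L} \<inter> - S)"
  shows "card {x. x < 2 ^ L \<and> digits_off L S x = j} = 2 ^ card ({..<L} \<inter> S)"
  using assms
proof (induction L arbitrary: S j)
  case (Suc L)
  let ?F = "\<lambda>j. {x. x < 2 ^ L \<and> digits_off L (Suc -` S) x = j}"
  show ?case
  proof (cases "0 \<in> S")
    case True
    then have IH: "card (?F j) = 2 ^ card ({..<L} \<inter> Suc -` S)"
      using Suc.prems Suc.IH[of j "Suc -` S"] unfolding card_lessThan_Suc_Int by (simp add: vimage_Compl)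
    \<comment> \<open>The lowest digit is free here, so each element of the smaller fibre extends in
      two ways.\<close>
    have "{x. x < 2 ^ Suc L \<and> digits_off (Suc L) S x = j}
        = (\<lambda>x. 2 * x) ` ?F j \<union> (\<lambda>x. 2 * x + 1) ` ?F j" (is "?A = ?B")
    proof
      show "?A \<subseteq> ?B"
      proof
        fix x assume "x \<in> ?A"
        then have "x div 2 \<in> ?F j" using True by auto
        moreover have "x = 2 * (x div 2) \<or> x = 2 * (x div 2) + 1" by presburger
        ultimately show "x \<in> ?B" by blast
      qed
    qed (use True in auto)
    moreover have "card ?B = card (?F j) + card (?F j)"
    proof (subst card_Un_disjoint)
      show "(\<lambda>x. 2 * x) ` ?F j \<inter> (\<lambda>x. 2 * x + 1) ` ?F j = {}"
        by (auto) presburger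
    qed (auto simp: card_image inj_on_def)
    ultimately show ?thesis using IH True unfolding card_lessThan_Suc_Int by simp
  next
    case False
    then have IH: "card (?F (j div 2)) = 2 ^ card ({..<L} \<inter> Suc -` S)"
      using Suc.prems Suc.IH[of "j div 2" "Suc -` S"]
      unfolding card_lessThan_Suc_Int by (simp add: vimage_Compl)
    \<comment> \<open>The lowest digit is now retained, so it must be the lowest digit of
      \<open>j\<close>.\<close>
    have "{x. x < 2 ^ Suc L \<and> digits_off (Suc L) S x = j} = (\<lambda>x. 2 * x + j mod 2) ` ?F (j div 2)"
      (is "?A = ?B")
    proof
      show "?A \<subseteq> ?B"
      proof
        fix x assume "x \<in> ?A"
        then have x: "x < 2 * 2 ^ L" "j = 2 * digits_off L (Suc -` S) (x div 2) + x mod 2"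
          using False by auto
        have "x div 2 \<in> ?F (j div 2)" using x by simp
        moreover have "x = 2 * (x div 2) + j mod 2" using x(2) by simp
        ultimately show "x \<in> ?B" by blast
      qed
      show "?B \<subseteq> ?A"
      proof
        fix x assume "x \<in> ?B"
        then obtain y where y: "y < 2 ^ L" "digits_off L (Suc -` S) y = j div 2" "x = 2 * y + j mod 2"
          by auto
        have "x div 2 = y" "x mod 2 = j mod 2" using y(3) by simp_all
        moreover have "x < 2 * 2 ^ L" using y(1,3) mod_less_divisor[of 2 j] by linarith
        ultimately show "x \<in> ?A" using y(2) False by simp
      qed
    qed
    then show ?thesis using IH False unfolding card_lessThan_Suc_Int
      by (simp add: card_image inj_on_def)
  qed
qed simp

section \<open>Bounds at powers of two and the choice of digit positions\<close>

lemma T_two_adic_bounds: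
  fixes L S
  defines "a \<equiv> 2 ^ card ({..<L} \<inter> S)" and "b \<equiv> 2 ^ card ({..<L} \<inter> - S)"
  shows "fact a ^ b \<le> T (2 ^ L) (two_adic S)"
    and "T (2 ^ L) (two_adic (- S)) * fact a ^ b \<le> fact (2 ^ L)"
proof -
  \<comment> \<open>Subtracting 1 moves \<open>{1..2 ^ L}\<close> onto the numbers below
    \<open>2 ^ L\<close> without changing differences.\<close>
  let ?f = "\<lambda>x. digits_off L S (x - 1)"
  have clique: "nat \<bar>int x - int y\<bar> \<in> two_adic S"
    if "x \<in> {1..2 ^ L}" "y \<in> {1..2 ^ L}" "x \<noteq> y" "?f x = ?f y" for x y
  proof -
    have "nat \<bar>int (x - 1) - int (y - 1)\<bar> \<in> two_adic S"
      using that by (intro digits_off_eq_imp_two_adic[of _ L]) auto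
    then show ?thesis using that(1,2) by (simp add: of_nat_diff)
  qed
  have range: "?f ` {1..2 ^ L} \<subseteq> {..<b}"
    unfolding b_def using digits_off_less by auto
  have size: "card {x\<in>{1..2 ^ L}. ?f x = j} = a" if "j < b" for j
  proof -
    have "{x\<in>{1..2 ^ L}. ?f x = j} = Suc ` {x. x < 2 ^ L \<and> digits_off L S x = j}"
    proof (intro equalityI subsetI)
      fix x assume "x \<in> {x\<in>{1..2 ^ L}. ?f x = j}"
      then show "x \<in> Suc ` {x. x < 2 ^ L \<and> digits_off L S x = j}"
        by (intro image_eqI[of _ _ "x - 1"]) auto
    qed auto
    then show ?thesis
      using card_digits_off_fibre that unfolding a_def b_def by (simp add: card_image)
  qed
  have disj: "two_adic S \<inter> two_adic (- S) = {}" "0 \<notin> two_adic (- S)"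
    by (auto simp: two_adic_def)
  show "fact a ^ b \<le> T (2 ^ L) (two_adic S)"
    "T (2 ^ L) (two_adic (- S)) * fact a ^ b \<le> fact (2 ^ L)"
    using fibre_perms_bounds[OF clique range size disj] by blast+
qed

text \<open>Each of the \<open>k\<close> blocks of \<open>q\<close> consecutive numbers contributes
  its first \<open>r\<close> members.\<close>

lemma card_mod_less:
  fixes q r k :: nat
  assumes "r \<le> q"
  shows "card ({..<q * k} \<inter> {i. i mod q < r}) = r * k"
proof (cases "q = 0")
  case False
  show ?thesis
  proof (induction k)
    case (Suc k)
    have "{..<q * Suc k} \<inter> {i. i mod q < r} = ({..<q * k} \<inter> {i. i mod q < r}) \<union> (+) (q * k) ` {..<r}"
      (is "?A = ?B")
    proof (intro equalityI subsetI)
      fix i assume i: "i \<in> ?A"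
      show "i \<in> ?B"
      proof (cases "i < q * k")
        case nl: False
        define j where "j = i - q * k"
        have j: "i = q * k + j" "j < q" using i nl by (auto simp: j_def)
        then have "j < r" using i by simp
        then show ?thesis using j by auto
      qed (use i in auto)
    qed (use assms in auto)
    moreover have "card ?B = card ({..<q * k} \<inter> {i. i mod q < r}) + card ((+) (q * k) ` {..<r})"
      by (rule card_Un_disjoint) auto
    ultimately show ?case using Suc by (simp add: card_image)
  qed simp
qed (use assms in simp)

theorem theorem3:
  fixes \<alpha> :: real
  assumes "\<alpha> \<in> \<rat>" and "0 < \<alpha>" and "\<alpha> < 1"
  shows "\<exists>E :: nat set. E \<subseteq> {1..} \<and>
    infinite {n :: nat. n > 0 \<and> (\<exists>a b :: nat.
      real a = real n powr \<alpha> \<and> real b = real n powr (1 - \<alpha>) \<and>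
      (fact a :: real) ^ b \<le> real (T n E) \<and>
      real (T n E) \<le> (fact n :: real) / (fact b :: real) ^ a \<and>
      (fact b :: real) ^ a \<le> real (T n ({1..} - E)) \<and>
      real (T n ({1..} - E)) \<le> (fact n :: real) / (fact a :: real) ^ b)}"
proof -
  obtain r q :: nat where q: "q \<noteq> 0" and "\<bar>\<alpha>\<bar> = real r / real q"
    using Rats_abs_nat_div_natE[OF assms(1)] by metis
  then have \<alpha>: "\<alpha> = real r / real q" using assms(2) by simp
  then have "real r < real q" using assms(3) q by (simp add: divide_less_eq)
  then have rq: "r \<le> q" by simp
  define S where "S = {i. i mod q < r}"
  define E where "E = two_adic S"
  have compl: "{1..} - E = two_adic (- S)" by (auto simp: E_def two_adic_def)
  let ?N = "{n :: nat. n > 0 \<and> (\<exists>a b :: nat.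
      real a = real n powr \<alpha> \<and> real b = real n powr (1 - \<alpha>) \<and>
      (fact a :: real) ^ b \<le> real (T n E) \<and>
      real (T n E) \<le> (fact n :: real) / (fact b :: real) ^ a \<and>
      (fact b :: real) ^ a \<le> real (T n ({1..} - E)) \<and>
      real (T n ({1..} - E)) \<le> (fact n :: real) / (fact a :: real) ^ b)}"
  have "2 ^ (q * k) \<in> ?N" for k
  proof -
    \<comment> \<open>As \<alpha> is \<open>r / q\<close>, these are the powers of \<open>n\<close>
      with exponents \<alpha> and 1 - \<alpha>.\<close>
    define n a b :: nat where "n = 2 ^ (q * k)" and "a = 2 ^ (r * k)" and "b = 2 ^ ((q - r) * k)"
    have cS: "card ({..<q * k} \<inter> S) = r * k"
      unfolding S_def using rq by (rule card_mod_less)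
    have "card ({..<q * k} \<inter> S) + card ({..<q * k} \<inter> - S) = card {..<q * k}"
      by (subst card_Un_disjoint[symmetric]) (auto simp flip: Int_Un_distrib)
    then have cS': "card ({..<q * k} \<inter> - S) = (q - r) * k"
      using cS by (simp add: diff_mult_distrib)
    have n: "real n = 2 powr (real q * real k)"
      unfolding n_def by (simp add: powr_realpow[symmetric])
    have "real a = real n powr \<alpha>"
      unfolding n powr_powr a_def \<alpha> using q by (simp add: powr_realpow[symmetric] mult.commute)
    moreover have "real b = real n powr (1 - \<alpha>)"
    proof -
      have "real q * real k * (1 - \<alpha>) = real ((q - r) * k)"
        unfolding \<alpha> using q rq by (simp add: of_nat_diff field_simps)
      then show ?thesis
        unfolding n powr_powr b_def by (simp only: powr_realpow) simp
    qed
    moreover have "fact a ^ b \<le> T n E" "T n ({1..} - E) * fact a ^ b \<le> fact n"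
      using T_two_adic_bounds[of "q * k" S] cS cS'
      unfolding compl by (simp_all add: E_def n_def a_def b_def)
    \<comment> \<open>Passing from \<open>S\<close> to \<open>- S\<close> exchanges \<open>a\<close>
      with \<open>b\<close> and \<open>E\<close> with its complement.\<close>
    moreover have "fact b ^ a \<le> T n ({1..} - E)" "T n E * fact b ^ a \<le> fact n"
      using T_two_adic_bounds[of "q * k" "- S"] cS cS'
      unfolding compl by (simp_all add: E_def n_def a_def b_def)
    moreover have "(fact c :: real) ^ d \<le> real x" if "fact c ^ d \<le> x" for x c d
      using of_nat_mono[OF that, where 'a = real] by simp
    moreover have "real x \<le> fact n / (fact c :: real) ^ d" if "x * fact c ^ d \<le> fact n" for x c d
      using of_nat_mono[OF that, where 'a = real] by (simp add: le_divide_eq)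
    moreover have "n > 0" by (simp add: n_def)
    ultimately show ?thesis
      unfolding n_def[symmetric] by blast
  qed
  then have "range (\<lambda>k. 2 ^ (q * k)) \<subseteq> ?N" by blast
  moreover have "infinite (range (\<lambda>k. 2 ^ (q * k) :: nat))"
    using q by (intro range_inj_infinite) (auto simp: inj_def)
  ultimately have "infinite ?N" using finite_subset by blast
  moreover have "E \<subseteq> {1..}" by (auto simp: E_def two_adic_def)
  ultimately show ?thesis by blast
qed

end
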